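(* Assume (A1)–(A6) of the context. Then for all time steps $k\ge 0$ and all episodes $j\ge 1$, the MPC problem $$\hat V^j(x)=\min_u\ \ell(x,u)+\sum_{m=1}^M p_mQ^{j-1}(Ax+Bu+\tilde w_m)\quad\text{s.t. } x\in\mathcal X,\ u\in\mathcal U,\ Ax+Bu\in\mathcal{SS}^{j-1}\ominus\mathcal W$$ is feasible at $x=x_k^j$, whenever the state $x_k^j$ is obtained by applying the MPC policy $\pi^{j\star}$ to the system $x_{k+1}^j=Ax_k^j+B\pi^{j\star}(x_k^j)+w_k^j$, $w_k^j\in\mathcal W$, starting from the initial state $x_0^j=x_S$.
   Context: System and constraints. $x_{k+1}=Ax_k+Bu_k+w_k$, $x_k\in\mathbb R^{n_x}$, $u_k\in\mathbb R^{n_u}$, $A,B$ known; constraints $x_k\in\mathcal X=\{x: H_xx\le h_x\}$ (a polyhedron), $u_k\in\mathcal U=\{u: H_uu\le h_u\}$ (a nonempty polytope). Notation: $\mathcal S\ominus\mathcal Y=\{x\in\mathcal S: x+y\in\mathcal S\ \forall y\in\mathcal Y\}$, $\oplus$ is the Minkowski sum, $[\cdot]_i$ is the $i$-th column (or component). The control task is repeated in episodes $j=0,1,2,\dots$, each starting at $x_0^j=x_S$ and ending at a time $T^j$ with $x^j_{T^j}\in\mathcal O$. (A1) The $w_k$ are i.i.d., zero mean, with known distribution $p(w)$ and support $\mathcal W=\{w: H_ww\le h_w\}$, a nonempty polytope with the origin in its interior and vertices $v_1^{\mathcal W},\dots,v_{l_w}^{\mathcal W}$. (A2) $x_S\in\mathcal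 X$. (A3) $\mathcal O\subseteq\mathcal X$ is a polytope with nonempty relative interior and vertices $v_1^{\mathcal O},\dots,v_{l_{\mathcal O}}^{\mathcal O}$, and is robust positive invariant for $x_{k+1}=(A+BK)x_k+w_k$, $w_k\in\mathcal W$, where $K$ is a given gain with $A+BK$ stable (all eigenvalues in the open unit disc). Put $\mathcal{KO}=\{Kx: x\in\mathcal O\}$. (A4) The stage cost $\ell:\mathcal X\times\mathcal U\to\mathbb R$ is differentiable and jointly convex, $\ell(x,u)=0$ for all $x\in\mathcal O$, $u\in\mathcal{KO}$, and $\ell(x,u)>0$ for all $x\in\mathcal X\setminus\mathcal O$, $u\in\mathcal U\setminus\mathcal{KO}$. Discretized disturbances. $\tilde w_1,\dots,\tilde w_M\in\mathcal W$ are sample points including all vertices of $\mathcal W$. For each $w\in\mathcal W$ convex coefficients $\mu_m(w)\ge0$, $\sum_m\mu_m(w)=1$, with $w=\sum_{m=1}^M\mu_m(w)\tilde w_m$ are fixed, and $p_m=\mathbb E_w[\mu_m(w)]$. (A5) For each $w\in\mathcal W$ there is $\delta(w,M)>0$ with $\|w-\tilde w_m\|\le\delta(w,M)$ for every $m$ with $\mu_m(w)\ne0$; and if, starting from $M_1$ samples, further disturbances are sampled in $\mathcal W$ keeping the earlier ones, then there is $N>M_1$ such that $\delta(w,M_1)>\delta(w,M_2)$ for all $M_2\ge N$. Initialization. (A6) A sub-optimal (feasible) controller for the problem of minimizing $\mathbb E[\sum_{k\ge0}\ell(x_k,\pi(x_k))]$ over state feedback policies, subject to the dynamics from $x_S$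 and the constraints for all disturbance realizations, is available and ends the episode in finite time. It is taken to be a tube controller: $\mathcal E$ is a polytopic robust positive invariant set for $x_{k+1}=(A+BK)x_k+w_k$, $w_k\in\mathcal W$; nominal sequences satisfy $\bar x_{k+1}=A\bar x_k+B\bar u_k$, $\bar x_0=x_S$, $\bar x_{k+1}\in\mathcal X\ominus\mathcal E$, $\bar u_k\in\mathcal U\ominus K\mathcal E$ for $0\le k\le T_0$, $\bar x_{T_0+1}\in\mathcal O\ominus\mathcal E$; $\pi_{\rm Tube}(x)=\bar u_k+K(x-\bar x_k)$ at time $k$; $\mathcal E_k=\bar x_k\oplus\mathcal E$, $0\le k\le T_0+1$. The columns of $\mathbf X^0$ are the vertices of $\mathcal O$ and of $\mathcal E_0,\dots,\mathcal E_{T_0+1}$. The columns of $\mathbf U^0$ are the corresponding inputs: $\pi_{\rm Tube}(v)$ for a vertex $v$ of $\mathcal E_k$, $k\le T_0$, and $Kv$ for vertices of $\mathcal O$ and $\mathcal E_{T_0+1}\subseteq\mathcal O$. The entries of the row vector $\mathbf J^0$ are $0$ for vertices of $\mathcal O$ and $J_k^0$ for vertices of $\mathcal E_k$, where $J^0_{T_0+1}=0$ and $J_k^0=\max_{x\in\mathcal E_k}\ell(x,\pi_{\rm Tube}(x))+J_{k+1}^0$. Safe set and value function. For $j\ge0$, $\mathcal{SS}^j$ is the convex hull of the columns of $\mathbf X^j$, and for $x\in\mathcal{SS}^j$ $$Q^j(x)=\min_{\lambda}\{\mathbf J^j\lambda:\ \mathbf X^j\lambda=x,\ \lambda\ge0,\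 \mathbf 1^\top\lambda=1\}.$$ MPC. For $j\ge1$, $\pi^{j\star}(x)$ denotes an optimal input of the problem defining $\hat V^j(x)$ in the claim; in episode $j$ the input $u_k^j=\pi^{j\star}(x_k^j)$ is applied. Data update after episode $j\ge1$. For each $k=0,\dots,T^j$ exploration yields states $x_1^{\mathcal W\star},\dots,x_{l_w}^{\mathcal W\star}$ (depending on $k,j$), as follows. Write $\mathcal{SS}^{j-1}\ominus\mathcal W=\{x: Hx\le h\}$, let $f_k^j(u)=\ell(x_k^j,u)+\sum_mp_mQ^{j-1}(Ax_k^j+Bu+\tilde w_m)$, let $u^\star=\pi^{j\star}(x_k^j)$, and let $\nu,\gamma\ge0$ be optimal multipliers of $H(Ax_k^j+Bu)\le h$ and $H_uu\le h_u$. If $\nu\neq0$, maximize $\nu^\top HBd$ over $d\in\mathbb R^{n_u}$ and $u_1^{\mathcal W},\dots,u_{l_w}^{\mathcal W}$ subject to $\nabla f_k^j(u^\star)^\top d\le0$, $Ax_k^j+B(u^\star+d)\in\mathcal X\ominus\mathcal W$, $u^\star+d\in\mathcal U$, and, for all $i$, $x_i^{\mathcal W}=Ax_k^j+B(u^\star+d)+v_i^{\mathcal W}$, $Ax_i^{\mathcal W}+Bu_i^{\mathcal W}\in\mathcal{SS}^{j-1}\ominus\mathcal W$, $u_i^{\mathcal W}\in\mathcal U$; the $x_i^{\mathcal W\star}$ are the optimal $x_i^{\mathcal W}$. If $\nu=0$, the $x_i^{\mathcal W\star}$ are sampled from a Gaussian with mean $x_k^j$ and identity covariance truncated to $\mathcal{SS}^{j-1}$.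 Then $\mathbf X^j$ is $\mathbf X^{j-1}$ with the columns $x_0^j,\dots,x_{T^j}^j$ and all explored states appended; $\mathbf U^j$ and $\mathbf J^j$ are $\mathbf U^{j-1}$ and $\mathbf J^{j-1}$ with $\pi^{j\star}(x)$ and $\hat V^j(x)$ appended for each appended state $x$. *)

theory Defs
  imports "HOL-Probability.Probability"
begin

definition pdiff :: "'a::plus set \<Rightarrow> 'a set \<Rightarrow> 'a set"  (infixl "\<ominus>" 65)
  where "S \<ominus> Y = {x \<in> S. \<forall>y\<in>Y. x + y \<in> S}"

definition enumerates_vertices :: "'a::real_vector list \<Rightarrow> 'a set \<Rightarrow> bool"
  where "enumerates_vertices vs S \<longleftrightarrow> distinct vs \<and> set vs = {v. v extreme_point_of S}"

definition rpi :: "real^'n^'n \<Rightarrow> (real^'n) set \<Rightarrow> (real^'n) set \<Rightarrow> bool"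
  where "rpi F \<W> S \<longleftrightarrow> (\<forall>x\<in>S. \<forall>w\<in>\<W>. F *v x + w \<in> S)"

text \<open>All complex eigenvalues of the real matrix lie in the open unit disc.\<close>

definition schur_stable :: "real^'n^'n \<Rightarrow> bool"
  where "schur_stable F \<longleftrightarrow>
    (\<forall>z v. v \<noteq> 0 \<and> (\<chi> i j. complex_of_real (F $ i $ j)) *v v = z *s v \<longrightarrow> cmod z < 1)"

definition measure_support :: "'a::topological_space measure \<Rightarrow> 'a set"
  where "measure_support M = {x. \<forall>G. open G \<and> x \<in> G \<longrightarrow> emeasure M G > 0}"

definition zero_mean_law :: "(real^'n) set \<Rightarrow> (real^'n) measure \<Rightarrow> bool"
  where "zero_mean_law \<W> P \<longleftrightarrow>
    prob_space P \<and> sets P = sets borel \<and> measure_support P = \<W> \<and>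
    integrable P (\<lambda>w. w) \<and> (\<integral>w. w \<partial>P) = 0"

text \<open>\<open>w j k\<close> is the disturbance at time \<open>k\<close> of episode \<open>j\<close>.\<close>

definition iid_process ::
    "'o measure \<Rightarrow> (real^'n) measure \<Rightarrow> (nat \<Rightarrow> nat \<Rightarrow> 'o \<Rightarrow> real^'n) \<Rightarrow> bool"
  where "iid_process \<Omega> P w \<longleftrightarrow>
    prob_space \<Omega> \<and>
    prob_space.indep_vars \<Omega> (\<lambda>_. borel) (\<lambda>(j, k). w j k) UNIV \<and>
    (\<forall>j k. distr \<Omega> borel (w j k) = P)"

text \<open>
  Finite families of disturbance samples are lists. Both the convex coefficients \<open>\<mu>\<close> and the
  radii \<open>\<delta>\<close> depend on the family, because the radii are compared between families of
  different size.
\<close>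

definition sample_list :: "(real^'n) set \<Rightarrow> (real^'n) list \<Rightarrow> bool"
  where "sample_list \<W> ws \<longleftrightarrow> set ws \<subseteq> \<W> \<and> {v. v extreme_point_of \<W>} \<subseteq> set ws"

definition convex_coefficients ::
    "(real^'n) set \<Rightarrow> ((real^'n) list \<Rightarrow> nat \<Rightarrow> real^'n \<Rightarrow> real) \<Rightarrow> bool"
  where "convex_coefficients \<W> \<mu> \<longleftrightarrow>
    (\<forall>ws. sample_list \<W> ws \<longrightarrow> (\<forall>w\<in>\<W>.
      (\<forall>m<length ws. 0 \<le> \<mu> ws m w) \<and>
      (\<Sum>m<length ws. \<mu> ws m w) = 1 \<and>
      (\<Sum>m<length ws. \<mu> ws m w *\<^sub>R ws ! m) = w))"

text \<open>
  In the second conjunct the sequence \<open>s\<close> extends its first \<open>M1\<close> samples by further ones.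
\<close>

definition sampling_radii ::
    "(real^'n) set \<Rightarrow> ((real^'n) list \<Rightarrow> nat \<Rightarrow> real^'n \<Rightarrow> real)
      \<Rightarrow> (real^'n \<Rightarrow> (real^'n) list \<Rightarrow> real) \<Rightarrow> bool"
  where "sampling_radii \<W> \<mu> \<delta> \<longleftrightarrow>
    (\<forall>ws. sample_list \<W> ws \<longrightarrow> (\<forall>w\<in>\<W>. \<delta> w ws > 0 \<and>
      (\<forall>m<length ws. \<mu> ws m w \<noteq> 0 \<longrightarrow> norm (w - ws ! m) \<le> \<delta> w ws))) \<and>
    (\<forall>s M1. range s \<subseteq> \<W> \<and> sample_list \<W> (map s [0..<M1]) \<longrightarrow>
      (\<forall>w\<in>\<W>. \<exists>N>M1. \<forall>M2\<ge>N. \<delta> w (map s [0..<M1]) > \<delta> w (map s [0..<M2])))"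

text \<open>
  The cost is a function on \<open>\<X> \<times> \<U>\<close>, so its values outside that set are irrelevant. That it can
  be evaluated on \<open>\<O> \<times> K\<O>\<close> (given \<open>\<O> \<subseteq> \<X>\<close>) is the conjunct \<open>K\<O> \<subseteq> \<U>\<close>.
\<close>

definition stage_cost ::
    "(real^'n) set \<Rightarrow> (real^'m) set \<Rightarrow> (real^'n) set \<Rightarrow> real^'n^'m
      \<Rightarrow> (real^'n \<Rightarrow> real^'m \<Rightarrow> real) \<Rightarrow> bool"
  where "stage_cost \<X> \<U> \<O> K l \<longleftrightarrow>
    (\<lambda>(x, u). l x u) differentiable_on (\<X> \<times> \<U>) \<and>
    convex_on (\<X> \<times> \<U>) (\<lambda>(x, u). l x u) \<and>
    (*v) K ` \<O> \<subseteq> \<U> \<and>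
    (\<forall>x\<in>\<O>. \<forall>u \<in> (*v) K ` \<O>. l x u = 0) \<and>
    (\<forall>x \<in> \<X> - \<O>. \<forall>u \<in> \<U> - (*v) K ` \<O>. l x u > 0)"

definition tube_section :: "(nat \<Rightarrow> real^'n) \<Rightarrow> (real^'n) set \<Rightarrow> nat \<Rightarrow> (real^'n) set"
  where "tube_section xb \<E> k = (\<lambda>e. xb k + e) ` \<E>"

definition tube_input ::
    "real^'n^'m \<Rightarrow> (nat \<Rightarrow> real^'n) \<Rightarrow> (nat \<Rightarrow> real^'m) \<Rightarrow> nat \<Rightarrow> real^'n \<Rightarrow> real^'m"
  where "tube_input K xb ub k x = ub k + K *v (x - xb k)"

text \<open>
  The last conjunct says that \<open>l x (tube_input K xb ub 0 x)\<close>, whose maximum over the initial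
  section is the first tube cost below, is evaluated inside the domain \<open>\<X> \<times> \<U>\<close> of the cost; for
  the inputs and for the later sections this follows from the other conjuncts.
\<close>

definition tube_controller ::
    "real^'n^'n \<Rightarrow> real^'m^'n \<Rightarrow> real^'n^'m \<Rightarrow> (real^'n) set \<Rightarrow> (real^'m) set \<Rightarrow> (real^'n) set
      \<Rightarrow> (real^'n) set \<Rightarrow> real^'n \<Rightarrow> (real^'n) set \<Rightarrow> nat
      \<Rightarrow> (nat \<Rightarrow> real^'n) \<Rightarrow> (nat \<Rightarrow> real^'m) \<Rightarrow> bool"
  where "tube_controller A B K \<X> \<U> \<W> \<O> xS \<E> T0 xb ub \<longleftrightarrow>
    polytope \<E> \<and> \<E> \<noteq> {} \<and> rpi (A + B ** K) \<W> \<E> \<and>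
    xb 0 = xS \<and>
    (\<forall>k\<le>T0. xb (Suc k) = A *v xb k + B *v ub k \<and>
             xb (Suc k) \<in> \<X> \<ominus> \<E> \<and> ub k \<in> \<U> \<ominus> (*v) K ` \<E>) \<and>
    xb (Suc T0) \<in> \<O> \<ominus> \<E> \<and>
    tube_section xb \<E> 0 \<subseteq> \<X>"

text \<open>The supremum is a maximum: the cost is continuous and the section compact.\<close>

function tube_cost ::
    "(real^'n \<Rightarrow> real^'m \<Rightarrow> real) \<Rightarrow> real^'n^'m \<Rightarrow> (real^'n) set \<Rightarrow> nat
      \<Rightarrow> (nat \<Rightarrow> real^'n) \<Rightarrow> (nat \<Rightarrow> real^'m) \<Rightarrow> nat \<Rightarrow> real"
  where "tube_cost l K \<E> T0 xb ub k =
    (if k \<le> T0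
     then (SUP x \<in> tube_section xb \<E> k. l x (tube_input K xb ub k x))
            + tube_cost l K \<E> T0 xb ub (Suc k)
     else 0)"
  by auto
termination
  by (relation "Wellfounded.measure (\<lambda>(_, _, _, T0, _, _, k). Suc T0 - k)") auto

declare tube_cost.simps [simp del]

text \<open>\<open>vO\<close> and \<open>vE k\<close> list the vertices of \<open>\<O>\<close> and of the \<open>k\<close>-th tube section.\<close>

definition init_states ::
    "(real^'n) list \<Rightarrow> (nat \<Rightarrow> (real^'n) list) \<Rightarrow> nat \<Rightarrow> (real^'n) list"
  where "init_states vO vE T0 = vO @ concat (map vE [0..<T0 + 2])"

definition init_inputs ::
    "real^'n^'m \<Rightarrow> (nat \<Rightarrow> real^'n) \<Rightarrow> (nat \<Rightarrow> real^'m) \<Rightarrow> (real^'n) list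
      \<Rightarrow> (nat \<Rightarrow> (real^'n) list) \<Rightarrow> nat \<Rightarrow> (real^'m) list"
  where "init_inputs K xb ub vO vE T0 =
    map ((*v) K) vO
    @ concat (map (\<lambda>k. map (tube_input K xb ub k) (vE k)) [0..<T0 + 1])
    @ map ((*v) K) (vE (T0 + 1))"

definition init_costs ::
    "(nat \<Rightarrow> real) \<Rightarrow> (real^'n) list \<Rightarrow> (nat \<Rightarrow> (real^'n) list) \<Rightarrow> nat \<Rightarrow> real list"
  where "init_costs J0 vO vE T0 =
    map (\<lambda>_. 0) vO @ concat (map (\<lambda>k. map (\<lambda>_. J0 k) (vE k)) [0..<T0 + 2])"

text \<open>Data matrices are represented by the lists of their columns.\<close>

definition safe_set :: "(real^'n) list \<Rightarrow> (real^'n) set"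
  where "safe_set Xs = convex hull (set Xs)"

text \<open>
  On the safe set the infimum is attained, being the value of a feasible linear program over a
  compact set; off the safe set the value is unspecified and never used.
\<close>

definition value_fun :: "(real^'n) list \<Rightarrow> real list \<Rightarrow> real^'n \<Rightarrow> real"
  where "value_fun Xs Js x =
    Inf {(\<Sum>i<length Xs. Js ! i * c i) | c.
          (\<Sum>i<length Xs. c i *\<^sub>R Xs ! i) = x \<and> (\<forall>i<length Xs. c i \<ge> 0) \<and>
          (\<Sum>i<length Xs. c i) = (1::real)}"

definition mpc_inputs ::
    "real^'n^'n \<Rightarrow> real^'m^'n \<Rightarrow> (real^'n) set \<Rightarrow> (real^'m) set \<Rightarrow> (real^'n) set
      \<Rightarrow> (real^'n) list \<Rightarrow> real^'n \<Rightarrow> (real^'m) set"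
  where "mpc_inputs A B \<X> \<U> \<W> Xs x =
    {u. x \<in> \<X> \<and> u \<in> \<U> \<and> A *v x + B *v u \<in> safe_set Xs \<ominus> \<W>}"

definition mpc_feasible ::
    "real^'n^'n \<Rightarrow> real^'m^'n \<Rightarrow> (real^'n) set \<Rightarrow> (real^'m) set \<Rightarrow> (real^'n) set
      \<Rightarrow> (real^'n) list \<Rightarrow> real^'n \<Rightarrow> bool"
  where "mpc_feasible A B \<X> \<U> \<W> Xs x \<longleftrightarrow> mpc_inputs A B \<X> \<U> \<W> Xs x \<noteq> {}"

text \<open>
  All vectors \<open>A *v x + B *v u + ws ! m\<close> occurring for an admissible input lie in the safe set.
\<close>

definition mpc_cost ::
    "real^'n^'n \<Rightarrow> real^'m^'n \<Rightarrow> (real^'n \<Rightarrow> real^'m \<Rightarrow> real) \<Rightarrow> (real^'n) list \<Rightarrow> (nat \<Rightarrow> real)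
      \<Rightarrow> (real^'n) list \<Rightarrow> real list \<Rightarrow> real^'n \<Rightarrow> real^'m \<Rightarrow> real"
  where "mpc_cost A B l ws p Xs Js x u =
    l x u + (\<Sum>m<length ws. p m * value_fun Xs Js (A *v x + B *v u + ws ! m))"

definition mpc_value ::
    "real^'n^'n \<Rightarrow> real^'m^'n \<Rightarrow> (real^'n) set \<Rightarrow> (real^'m) set \<Rightarrow> (real^'n) set
      \<Rightarrow> (real^'n \<Rightarrow> real^'m \<Rightarrow> real) \<Rightarrow> (real^'n) list \<Rightarrow> (nat \<Rightarrow> real)
      \<Rightarrow> (real^'n) list \<Rightarrow> real list \<Rightarrow> real^'n \<Rightarrow> real"
  where "mpc_value A B \<X> \<U> \<W> l ws p Xs Js x =
    (INF u \<in> mpc_inputs A B \<X> \<U> \<W> Xs x. mpc_cost A B l ws p Xs Js x u)"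

definition mpc_optimal ::
    "real^'n^'n \<Rightarrow> real^'m^'n \<Rightarrow> (real^'n) set \<Rightarrow> (real^'m) set \<Rightarrow> (real^'n) set
      \<Rightarrow> (real^'n \<Rightarrow> real^'m \<Rightarrow> real) \<Rightarrow> (real^'n) list \<Rightarrow> (nat \<Rightarrow> real)
      \<Rightarrow> (real^'n) list \<Rightarrow> real list \<Rightarrow> real^'n \<Rightarrow> real^'m \<Rightarrow> bool"
  where "mpc_optimal A B \<X> \<U> \<W> l ws p Xs Js x u \<longleftrightarrow>
    is_arg_min (mpc_cost A B l ws p Xs Js x) (\<lambda>u. u \<in> mpc_inputs A B \<X> \<U> \<W> Xs x) u"

text \<open>
  The objective of the MPC problem is convex on its feasible set \<open>F\<close> but, the value function being
  piecewise linear, it need not be differentiable. The gradient at the optimal input is the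
  gradient where it exists and a subgradient otherwise.
\<close>

definition gradient_at :: "(real^'m) set \<Rightarrow> (real^'m \<Rightarrow> real) \<Rightarrow> real^'m \<Rightarrow> real^'m \<Rightarrow> bool"
  where "gradient_at F f u g \<longleftrightarrow>
    (if f differentiable (at u within F)
     then (f has_derivative (\<lambda>d. g \<bullet> d)) (at u within F)
     else (\<forall>v\<in>F. f v \<ge> f u + g \<bullet> (v - u)))"

text \<open>
  Karush-Kuhn-Tucker multipliers of the constraints \<open>H i \<bullet> (A *v x + B *v u) \<le> h i\<close> (\<open>i < r\<close>) and
  \<open>Hu *v u \<le> hu\<close> at \<open>u\<close>, where \<open>g\<close> is the gradient of the objective. The number \<open>r\<close> of rows of
  \<open>H\<close> changes from episode to episode, so it is not a type.
\<close>

definition kkt_multipliers ::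
    "real^'n^'n \<Rightarrow> real^'m^'n \<Rightarrow> nat \<Rightarrow> (nat \<Rightarrow> real^'n) \<Rightarrow> (nat \<Rightarrow> real) \<Rightarrow> real^'m^'q \<Rightarrow> real^'q
      \<Rightarrow> real^'n \<Rightarrow> real^'m \<Rightarrow> real^'m \<Rightarrow> (nat \<Rightarrow> real) \<Rightarrow> real^'q \<Rightarrow> bool"
  where "kkt_multipliers A B r H h Hu hu x u g \<nu> \<gamma> \<longleftrightarrow>
    (\<forall>i<r. \<nu> i \<ge> 0) \<and> (\<forall>i. \<gamma> $ i \<ge> 0) \<and>
    g + transpose B *v (\<Sum>i<r. \<nu> i *\<^sub>R H i) + transpose Hu *v \<gamma> = 0 \<and>
    (\<forall>i<r. \<nu> i * (H i \<bullet> (A *v x + B *v u) - h i) = 0) \<and>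
    (\<forall>i. \<gamma> $ i * ((Hu *v u) $ i - hu $ i) = 0)"

definition explored_state ::
    "real^'n^'n \<Rightarrow> real^'m^'n \<Rightarrow> (real^'n) list \<Rightarrow> real^'n \<Rightarrow> real^'m \<Rightarrow> real^'m \<Rightarrow> nat \<Rightarrow> real^'n"
  where "explored_state A B vW x u d i = A *v x + B *v (u + d) + vW ! i"

definition exploration_admissible ::
    "real^'n^'n \<Rightarrow> real^'m^'n \<Rightarrow> (real^'n) set \<Rightarrow> (real^'m) set \<Rightarrow> (real^'n) set
      \<Rightarrow> (real^'n) list \<Rightarrow> (real^'n) list \<Rightarrow> real^'n \<Rightarrow> real^'m \<Rightarrow> real^'m
      \<Rightarrow> real^'m \<Rightarrow> (nat \<Rightarrow> real^'m) \<Rightarrow> bool"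
  where "exploration_admissible A B \<X> \<U> \<W> vW Xs x u g d uW \<longleftrightarrow>
    g \<bullet> d \<le> 0 \<and>
    A *v x + B *v (u + d) \<in> \<X> \<ominus> \<W> \<and>
    u + d \<in> \<U> \<and>
    (\<forall>i<length vW.
       A *v explored_state A B vW x u d i + B *v uW i \<in> safe_set Xs \<ominus> \<W> \<and> uW i \<in> \<U>)"

text \<open>Normal distribution with mean \<open>a\<close> and identity covariance.\<close>

definition gaussian :: "real^'n \<Rightarrow> (real^'n) measure"
  where "gaussian a = density lborel
    (\<lambda>y. ennreal (exp (- (norm (y - a))\<^sup>2 / 2) / (2 * pi) powr (real CARD('n) / 2)))"

text \<open>
  \<open>explores \<dots> x u xW\<close>: the states \<open>xW 0, \<dots>, xW (length vW - 1)\<close> are an outcome of the exploration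
  at the state \<open>x\<close> with optimal input \<open>u\<close>. An outcome of sampling from a distribution is a point of
  its support; \<open>uniform_measure (gaussian x) S\<close> is the truncation of the Gaussian to \<open>S\<close>.
\<close>

definition explores ::
    "real^'n^'n \<Rightarrow> real^'m^'n \<Rightarrow> (real^'n) set \<Rightarrow> real^'m^'q \<Rightarrow> real^'q \<Rightarrow> (real^'n) set
      \<Rightarrow> (real^'n) list \<Rightarrow> (real^'n \<Rightarrow> real^'m \<Rightarrow> real) \<Rightarrow> (real^'n) list \<Rightarrow> (nat \<Rightarrow> real)
      \<Rightarrow> (real^'n) list \<Rightarrow> real list \<Rightarrow> real^'n \<Rightarrow> real^'m \<Rightarrow> (nat \<Rightarrow> real^'n) \<Rightarrow> bool"
  where "explores A B \<X> Hu hu \<W> vW l ws p Xs Js x u xW \<longleftrightarrow>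
    (let \<U> = {v. Hu *v v \<le> hu} in
     \<exists>r H h g \<nu> \<gamma>.
       safe_set Xs \<ominus> \<W> = {y. \<forall>i<r. H i \<bullet> y \<le> h i} \<and>
       gradient_at (mpc_inputs A B \<X> \<U> \<W> Xs x) (mpc_cost A B l ws p Xs Js x) u g \<and>
       kkt_multipliers A B r H h Hu hu x u g \<nu> \<gamma> \<and>
       (if \<exists>i<r. \<nu> i \<noteq> 0
        then \<exists>d uW.
          is_arg_max (\<lambda>(d, uW). \<Sum>i<r. \<nu> i * (H i \<bullet> (B *v d)))
            (\<lambda>(d, uW). exploration_admissible A B \<X> \<U> \<W> vW Xs x u g d uW) (d, uW) \<and>
          (\<forall>i<length vW. xW i = explored_state A B vW x u d i)
        else \<forall>i<length vW. xW i \<in> measure_support (uniform_measure (gaussian x) (safe_set Xs))))"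

text \<open>The columns appended after an episode with states \<open>x 0, \<dots>, x T\<close>, \<open>n\<close> explored per time step.\<close>

definition new_states ::
    "nat \<Rightarrow> nat \<Rightarrow> (nat \<Rightarrow> real^'n) \<Rightarrow> (nat \<Rightarrow> nat \<Rightarrow> real^'n) \<Rightarrow> (real^'n) list"
  where "new_states n T x xW =
    map x [0..<T + 1] @ concat (map (\<lambda>k. map (xW k) [0..<n]) [0..<T + 1])"

end

theory Submission
  imports Defs
begin

text \<open>
  Call a set of data invariant if every column is feasible for the MPC problem posed with these
  data. The feasible states form a convex set, so invariance passes to the whole safe set, and it is
  preserved by adding columns that are feasible for the old data: trajectory states, the states
  explored by the linear program (which carry their own admissible inputs), and samples from the
  old safe set. The tube data are invariant. That the initial state lies in the safe set means
  \<open>0 \<in> \<E>\<close>, which holds because by Brouwer \<open>A + BK\<close> has a fixed point in \<open>\<E>\<close>,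
  and 1 is not an eigenvalue of a stable matrix.
\<close>

section \<open>Set differences and polyhedral constraints\<close>

lemma pdiff_iff:
  fixes y :: "'a::monoid_add"
  assumes "0 \<in> W"
  shows "y \<in> S \<ominus> W \<longleftrightarrow> (\<forall>w\<in>W. y + w \<in> S)"
  using assms by (force simp: pdiff_def)

lemma pdiff_mono: "S \<subseteq> S' \<Longrightarrow> S \<ominus> W \<subseteq> S' \<ominus> W"
  by (auto simp: pdiff_def)

text \<open>The difference is the intersection of \<open>S\<close> with the translates
  \<open>S - w\<close>, all of which are convex.\<close>

lemma convex_pdiff:
  fixes S :: "'a::real_vector set"
  assumes "convex S"
  shows "convex (S \<ominus> W)"
proof -
  have "S \<ominus> W = S \<inter> (\<Inter>w\<in>W. (\<lambda>y. y - w) ` S)"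
    by (force simp: pdiff_def image_iff)
  then show ?thesis
    using assms by (simp add: convex_Int convex_INT convex_translation_subtract)
qed

lemma convex_matrix_le: "convex {x. H *v x \<le> (h::real^'r)}"
  for H :: "real^'n^'r"
proof -
  have "convex {y::real^'r. y \<le> h}"
    unfolding convex_alt less_eq_vec_def by (auto intro!: convex_bound_le)
  then have "convex ((*v) H -` {y. y \<le> h})"
    by (intro convex_linear_vimage matrix_vector_mul_linear)
  then show ?thesis
    by (simp add: vimage_def)
qed

section \<open>The origin in robust invariant sets\<close>

lemma schur_stable_fixed_point:
  assumes "schur_stable F" "F *v e = e"
  shows "e = 0"
proof (rule ccontr)
  assume "e \<noteq> 0"
  \<comment> \<open>Stability is stated for complex vectors, so \<open>e\<close> is read as one; it
    would be an eigenvector for the eigenvalue 1.\<close>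
  define v :: "complex^'a" where "v = (\<chi> i. complex_of_real (e $ i))"
  have "v \<noteq> 0"
    using \<open>e \<noteq> 0\<close> by (auto simp: v_def vec_eq_iff)
  moreover have "(\<chi> i j. complex_of_real (F $ i $ j)) *v v = 1 *s v"
  proof -
    have "(\<Sum>j\<in>UNIV. F $ i $ j * e $ j) = e $ i" for i
      using assms(2) by (simp add: matrix_vector_mult_def vec_eq_iff)
    then show ?thesis
      by (simp add: v_def vec_eq_iff matrix_vector_mult_def flip: of_real_mult of_real_sum)
  qed
  ultimately have "cmod 1 < 1"
    using assms(1) unfolding schur_stable_def by blast
  then show False by simp
qed

text \<open>As the disturbance 0 is allowed, \<open>F\<close> itself maps \<open>E\<close> into
  \<open>E\<close>, which is what Brouwer requires.\<close>

lemma zero_mem_rpi: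
  assumes "schur_stable F" "compact E" "convex E" "E \<noteq> {}" "rpi F W E" "0 \<in> W"
  shows "0 \<in> E"
proof -
  have "(*v) F ` E \<subseteq> E"
    using assms(5,6) by (force simp: rpi_def)
  then obtain e where "e \<in> E" "F *v e = e"
    using brouwer[of E "(*v) F"] assms(2-4)
    by (auto simp: image_subset_iff_funcset matrix_vector_mult_linear_continuous_on)
  then show ?thesis
    using schur_stable_fixed_point[OF assms(1)] by auto
qed

section \<open>Truncated measures, safe sets and vertices\<close>

lemma measure_support_uniform_measure_subset:
  assumes "sets M = sets borel" "closed S"
  shows "measure_support (uniform_measure M S) \<subseteq> S"
proof
  fix y assume y: "y \<in> measure_support (uniform_measure M S)"
  \<comment> \<open>The numerator is the measure of the empty set, and 0 / 0 = 0 in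
    \<open>ennreal\<close>, so a null set \<open>S\<close> is covered too, such as a safe set of
    lower dimension. The open set \<open>- S\<close> then misses the support.\<close>
  have "emeasure (uniform_measure M S) (- S) = 0"
    using assms by (subst emeasure_uniform_measure) (auto simp: Compl_eq_Diff_UNIV)
  then show "y \<in> S"
    using y assms(2) by (auto simp: measure_support_def open_Compl)
qed

lemma closed_safe_set: "closed (safe_set Xs)"
  unfolding safe_set_def
  by (simp add: compact_imp_closed finite_imp_compact_convex_hull)

lemma polytope_eq_hull_vertices:
  fixes S :: "'a::euclidean_space set"
  assumes "polytope S" "enumerates_vertices vs S"
  shows "S = convex hull (set vs)"
  using assms Krein_Milman_Minkowski[of S]
  by (simp add: enumerates_vertices_def polytope_imp_compact polytope_imp_convex)

lemma enumerates_vertices_subset: "enumerates_vertices vs S \<Longrightarrow> set vs \<subseteq> S"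
  by (auto simp: enumerates_vertices_def extreme_point_of_def)

section \<open>The set of feasible states\<close>

lemma mpc_feasible_iff:
  "mpc_feasible A B X U W Xs y \<longleftrightarrow>
    y \<in> X \<and> (\<exists>u\<in>U. A *v y + B *v u \<in> safe_set Xs \<ominus> W)"
  by (auto simp: mpc_feasible_def mpc_inputs_def)

text \<open>Appending columns enlarges the safe set and hence its difference with \<open>W\<close>;
  the other constraints do not involve the data.\<close>

lemma mpc_feasible_mono:
  assumes "mpc_feasible A B X U W Xs y" "set Xs \<subseteq> set Ys"
  shows "mpc_feasible A B X U W Ys y"
  using assms pdiff_mono[of "safe_set Xs" "safe_set Ys" W] hull_mono[of "set Xs" "set Ys" convex]
  unfolding mpc_feasible_iff safe_set_def by blast

text \<open>The dynamics are linear: at a convex combination of two states, the combination of their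
  inputs with the same weights is admissible.\<close>

lemma convex_mpc_feasible:
  assumes "convex X" "convex U"
  shows "convex {y. mpc_feasible A B X U W Xs y}"
proof (rule convexI)
  fix y z and s t :: real
  assume y: "y \<in> {y. mpc_feasible A B X U W Xs y}" and z: "z \<in> {y. mpc_feasible A B X U W Xs y}"
    and st: "0 \<le> s" "0 \<le> t" "s + t = 1"
  obtain u v where u: "y \<in> X" "u \<in> U" "A *v y + B *v u \<in> safe_set Xs \<ominus> W"
    and v: "z \<in> X" "v \<in> U" "A *v z + B *v v \<in> safe_set Xs \<ominus> W"
    using y z by (auto simp: mpc_feasible_iff)
  have "A *v (s *\<^sub>R y + t *\<^sub>R z) + B *v (s *\<^sub>R u + t *\<^sub>R v)
      = s *\<^sub>R (A *v y + B *v u) + t *\<^sub>R (A *v z + B *v v)"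
    by (simp add: matrix_vector_right_distrib matrix_vector_mult_scaleR algebra_simps)
  also have "\<dots> \<in> safe_set Xs \<ominus> W"
    using convexD[OF convex_pdiff u(3) v(3) st] by (simp add: safe_set_def)
  finally show "s *\<^sub>R y + t *\<^sub>R z \<in> {y. mpc_feasible A B X U W Xs y}"
    using convexD[OF assms(1) u(1) v(1) st] convexD[OF assms(2) u(2) v(2) st]
    by (auto simp: mpc_feasible_iff)
qed

lemma mpc_feasible_safe_set:
  assumes "convex X" "convex U" "\<And>v. v \<in> set Xs \<Longrightarrow> mpc_feasible A B X U W Xs v"
    and "y \<in> safe_set Xs"
  shows "mpc_feasible A B X U W Xs y"
proof -
  have "set Xs \<subseteq> {y. mpc_feasible A B X U W Xs y}"
    using assms(3) by blast
  then have "safe_set Xs \<subseteq> {y. mpc_feasible A B X U W Xs y}"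
    unfolding safe_set_def using convex_mpc_feasible[OF assms(1,2)] by (rule hull_minimal)
  then show ?thesis
    using assms(4) by blast
qed

section \<open>Feasibility of the tube data\<close>

lemma closed_loop_step:
  fixes A :: "real^'n^'n" and B :: "real^'m^'n" and K :: "real^'n^'m"
  shows "A *v e + B *v (K *v e) = (A + B ** K) *v e"
  by (simp add: matrix_vector_mult_add_rdistrib matrix_vector_mul_assoc)

lemma set_init_states:
  "set (init_states vO vE T0) = set vO \<union> (\<Union>k\<le>T0 + 1. set (vE k))"
  by (auto simp: init_states_def less_Suc_eq_le simp del: upt_Suc)

text \<open>The input \<open>K *v y\<close> keeps every successor in \<open>S\<close>, which is part
  of the safe set.\<close>

lemma mpc_feasible_terminal:
  assumes "0 \<in> W" "S \<subseteq> X" "(*v) K ` S \<subseteq> U" "rpi (A + B ** K) W S"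
    and "S \<subseteq> safe_set Xs" "y \<in> S"
  shows "mpc_feasible A B X U W Xs y"
proof -
  have "A *v y + B *v (K *v y) + w \<in> safe_set Xs" if "w \<in> W" for w
    using assms(4-6) that unfolding closed_loop_step by (auto simp: rpi_def)
  then show ?thesis
    unfolding mpc_feasible_iff pdiff_iff[OF assms(1)] using assms(2,3,6) by blast
qed

context
  fixes A :: "real^'n^'n" and B :: "real^'m^'n" and K :: "real^'n^'m"
    and X W C E :: "(real^'n) set" and U :: "(real^'m) set"
    and xS :: "real^'n" and T0 :: nat and xb :: "nat \<Rightarrow> real^'n" and ub :: "nat \<Rightarrow> real^'m"
  assumes tube: "tube_controller A B K X U W C xS E T0 xb ub"
begin

lemma tube_section_subset_states:
  assumes "k \<le> T0 + 1"
  shows "tube_section xb E k \<subseteq> X"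
\<comment> \<open>The nominal constraints concern \<open>xb (Suc i)\<close> only; section 0 has a
  clause of its own in \<open>tube_controller\<close>.\<close>
proof (cases k)
  case 0
  then show ?thesis using tube by (simp add: tube_controller_def)
next
  case (Suc i)
  then have "xb k \<in> X \<ominus> E"
    using tube assms by (auto simp: tube_controller_def)
  then show ?thesis by (auto simp: pdiff_def tube_section_def)
qed

lemma tube_section_last_subset: "tube_section xb E (Suc T0) \<subseteq> C"
  using tube by (auto simp: tube_controller_def pdiff_def tube_section_def)

lemma polytope_tube_section: "polytope (tube_section xb E k)"
  using tube unfolding tube_section_def tube_controller_def by (simp add: polytope_translation_eq)

text \<open>Under the tube input the deviation \<open>e\<close> from the nominal state evolves by
  \<open>A + B ** K\<close> plus the disturbance. It therefore stays in \<open>E\<close>, and the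
  successor lies in the next section.\<close>

lemma mpc_feasible_tube_section:
  assumes "0 \<in> W" "k \<le> T0" "tube_section xb E (Suc k) \<subseteq> safe_set Xs"
    and "y \<in> tube_section xb E k"
  shows "mpc_feasible A B X U W Xs y"
proof -
  obtain e where e: "e \<in> E" "y = xb k + e"
    using assms(4) by (auto simp: tube_section_def)
  \<comment> \<open>This is the tube input at \<open>y\<close>, since
    \<open>y - xb k = e\<close>.\<close>
  let ?u = "ub k + K *v e"
  have "?u \<in> U"
    using tube assms(2) e by (auto simp: tube_controller_def pdiff_def)
  moreover have "A *v y + B *v ?u + w \<in> safe_set Xs" if "w \<in> W" for w
  proof -
    have "A *v y + B *v ?u + w = xb (Suc k) + ((A + B ** K) *v e + w)"
      using tube assms(2) e
      by (simp add: tube_controller_def matrix_vector_right_distrib flip: closed_loop_step)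
    moreover have "(A + B ** K) *v e + w \<in> E"
      using tube e that by (auto simp: tube_controller_def rpi_def)
    ultimately show ?thesis
      using assms(3) by (auto simp: tube_section_def)
  qed
  moreover have "y \<in> X"
    using tube_section_subset_states[of k] assms(2,4) by auto
  ultimately show ?thesis
    by (auto simp: mpc_feasible_iff pdiff_iff[OF assms(1)])
qed

lemma tube_sections_subset_safe_set:
  assumes "\<forall>k\<le>T0 + 1. enumerates_vertices (vE k) (tube_section xb E k)" "k \<le> T0 + 1"
  shows "tube_section xb E k \<subseteq> safe_set (init_states vO vE T0)"
proof -
  have "set (vE k) \<subseteq> set (init_states vO vE T0)"
    using assms(2) unfolding set_init_states by blast
  then show ?thesis
    using polytope_eq_hull_vertices[OF polytope_tube_section, of "vE k" k] assms
    by (simp add: safe_set_def hull_mono)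
qed

text \<open>A vertex of section k \<le> \<open>T0\<close> is steered into section k + 1. All other
  columns lie in the terminal set \<open>C\<close>, where the gain \<open>K\<close> is used.\<close>

lemma mpc_feasible_init_states:
  assumes "0 \<in> W" "C \<subseteq> X" "polytope C" "enumerates_vertices vO C" "rpi (A + B ** K) W C"
    and "(*v) K ` C \<subseteq> U"
    and vE: "\<forall>k\<le>T0 + 1. enumerates_vertices (vE k) (tube_section xb E k)"
    and y: "y \<in> set (init_states vO vE T0)"
  shows "mpc_feasible A B X U W (init_states vO vE T0) y"
proof -
  have "C \<subseteq> safe_set (init_states vO vE T0)"
    using polytope_eq_hull_vertices[OF assms(3,4)]
    by (simp add: safe_set_def set_init_states hull_mono)
  then have C: "mpc_feasible A B X U W (init_states vO vE T0) z" if "z \<in> C" for z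
    using mpc_feasible_terminal assms that by blast
  from y consider "y \<in> set vO" | k where "k \<le> T0 + 1" "y \<in> set (vE k)"
    unfolding set_init_states by blast
  then show ?thesis
  proof cases
    case 1
    then show ?thesis
      using C enumerates_vertices_subset[OF assms(4)] by blast
  next
    case 2
    then have y_section: "y \<in> tube_section xb E k"
      using vE enumerates_vertices_subset by blast
    show ?thesis
    proof (cases "k \<le> T0")
      case True
      then show ?thesis
        using mpc_feasible_tube_section[OF assms(1) True _ y_section]
          tube_sections_subset_safe_set[OF vE] by simp
    next
      case False
      \<comment> \<open>The last section has no nominal input, but it is contained in
        \<open>C\<close>.\<close>
      then have "k = Suc T0" using 2 by simp
      then show ?thesis
        using C y_section tube_section_last_subset by blast
    qed
  qed
qed

text \<open>The state \<open>xS\<close> is the centre \<open>xb 0\<close> of section 0, so the claim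
  amounts to 0 \<in> \<open>E\<close>.\<close>

lemma initial_state_in_tube_section:
  assumes "0 \<in> W" "schur_stable (A + B ** K)"
  shows "xS \<in> tube_section xb E 0"
proof -
  have E: "polytope E" "E \<noteq> {}" "rpi (A + B ** K) W E" "xb 0 = xS"
    using tube by (simp_all add: tube_controller_def)
  have "0 \<in> E"
    using zero_mem_rpi[OF assms(2) polytope_imp_compact polytope_imp_convex] E assms(1) by blast
  then show ?thesis
    unfolding tube_section_def using E(4) by (intro image_eqI[of _ _ 0]) simp_all
qed

end

section \<open>Explored states and closed-loop trajectories\<close>

text \<open>The linear program supplies \<open>uW i\<close> as an admissible input at its
  \<open>i\<close>-th state. A sample lies in the support of the truncated Gaussian, hence in the
  safe set, where \<open>inv\<close> applies.\<close>

lemma mpc_feasible_explores: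
  assumes "explores A B X Hu hu W vW l ws p Xs Js y u xW" "i < length vW"
    and "enumerates_vertices vW W"
    and inv: "\<And>z. z \<in> safe_set Xs \<Longrightarrow> mpc_feasible A B X {v. Hu *v v \<le> hu} W Xs z"
  shows "mpc_feasible A B X {v. Hu *v v \<le> hu} W Xs (xW i)"
proof -
  let ?U = "{v. Hu *v v \<le> hu}"
  consider (lp) g d uW where
      "exploration_admissible A B X ?U W vW Xs y u g d uW" "xW i = explored_state A B vW y u d i"
    | (sampled) "xW i \<in> measure_support (uniform_measure (gaussian y) (safe_set Xs))"
    using assms(1,2) unfolding explores_def Let_def is_arg_max_def
    by (elim exE conjE) (simp split: if_splits; blast)
  then show ?thesis
  proof cases
    case lp
    \<comment> \<open>The undisturbed successor lies in \<open>X\<close> \<ominus> \<open>W\<close>,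
      so adding this vertex of \<open>W\<close> stays within \<open>X\<close>.\<close>
    have "vW ! i \<in> W"
      using assms(2,3) enumerates_vertices_subset nth_mem by blast
    then have "xW i \<in> X"
      using lp by (auto simp: exploration_admissible_def explored_state_def pdiff_def)
    then show ?thesis
      using lp assms(2) unfolding exploration_admissible_def mpc_feasible_iff by metis
  next
    case sampled
    moreover have "sets (gaussian y) = sets borel"
      by (simp add: gaussian_def)
    ultimately show ?thesis
      using measure_support_uniform_measure_subset[OF _ closed_safe_set] inv by blast
  qed
qed

text \<open>At a feasible state the policy is admissible, and its robust constraint sends the
  successor into the safe set for every disturbance in \<open>W\<close>.\<close>

lemma closed_loop_in_safe_set:
  assumes "x 0 \<in> safe_set Xs"
    and "\<And>z. z \<in> safe_set Xs \<Longrightarrow> mpc_feasible A B X U W Xs z"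
    and "\<And>z. mpc_feasible A B X U W Xs z \<Longrightarrow> mpc_optimal A B X U W l ws p Xs Js z (pol z)"
    and "\<And>k. x (Suc k) = A *v x k + B *v pol (x k) + d k" "\<And>k. d k \<in> W"
  shows "x k \<in> safe_set Xs"
proof (induction k)
  case (Suc k)
  then have "pol (x k) \<in> mpc_inputs A B X U W Xs (x k)"
    using assms(2,3) unfolding mpc_optimal_def is_arg_min_def by blast
  then show ?case
    using assms(4,5) by (simp add: mpc_inputs_def pdiff_def)
qed (use assms(1) in simp)

section \<open>Induction over the episodes\<close>

theorem theorem1:
  fixes A :: "real^'n^'n" and B :: "real^'m^'n" and K :: "real^'n^'m"
    and Hx :: "real^'n^'rx" and hx :: "real^'rx"
    and Hu :: "real^'m^'ru" and hu :: "real^'ru"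
    and Hw :: "real^'n^'rw" and hw :: "real^'rw"
    and \<X> \<W> \<O> \<E> :: "(real^'n) set" and \<U> :: "(real^'m) set"
    and P :: "(real^'n) measure"
    and \<Omega> :: "'o measure" and w :: "nat \<Rightarrow> nat \<Rightarrow> 'o \<Rightarrow> real^'n" and \<omega> :: 'o
    and vW vO :: "(real^'n) list" and vE :: "nat \<Rightarrow> (real^'n) list"
    and xS :: "real^'n"
    and l :: "real^'n \<Rightarrow> real^'m \<Rightarrow> real"
    and ws :: "(real^'n) list" and \<mu> :: "(real^'n) list \<Rightarrow> nat \<Rightarrow> real^'n \<Rightarrow> real"
    and \<delta> :: "real^'n \<Rightarrow> (real^'n) list \<Rightarrow> real" and p :: "nat \<Rightarrow> real"
    and T0 :: nat and xb :: "nat \<Rightarrow> real^'n" and ub :: "nat \<Rightarrow> real^'m"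
    and Xd :: "nat \<Rightarrow> (real^'n) list" and Ud :: "nat \<Rightarrow> (real^'m) list" and Jd :: "nat \<Rightarrow> real list"
    and pol :: "nat \<Rightarrow> real^'n \<Rightarrow> real^'m"
    and x :: "nat \<Rightarrow> nat \<Rightarrow> real^'n" and T :: "nat \<Rightarrow> nat"
    and xW :: "nat \<Rightarrow> nat \<Rightarrow> nat \<Rightarrow> real^'n"
    and j k :: nat
  assumes state_constraints: "\<X> = {x. Hx *v x \<le> hx}"
    and input_constraints: "\<U> = {u. Hu *v u \<le> hu}" "polytope \<U>" "\<U> \<noteq> {}"
    and disturbance_set: "\<W> = {w. Hw *v w \<le> hw}" "polytope \<W>" "\<W> \<noteq> {}" "0 \<in> interior \<W>"
      "enumerates_vertices vW \<W>"
    and disturbance_law: "zero_mean_law \<W> P" "iid_process \<Omega> P w"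
    and initial_state: "xS \<in> \<X>"
    and terminal_set: "\<O> \<subseteq> \<X>" "polytope \<O>" "rel_interior \<O> \<noteq> {}"
      "enumerates_vertices vO \<O>" "rpi (A + B ** K) \<W> \<O>" "schur_stable (A + B ** K)"
    and cost: "stage_cost \<X> \<U> \<O> K l"
    and samples: "sample_list \<W> ws"
    and coefficients: "convex_coefficients \<W> \<mu>"
    and weights: "\<forall>m<length ws. integrable P (\<mu> ws m) \<and> p m = (\<integral>w. \<mu> ws m w \<partial>P)"
    and radii: "sampling_radii \<W> \<mu> \<delta>"
    and tube: "tube_controller A B K \<X> \<U> \<W> \<O> xS \<E> T0 xb ub"
    and tube_vertices: "\<forall>k\<le>T0 + 1. enumerates_vertices (vE k) (tube_section xb \<E> k)"
    and initial_data:
      "Xd 0 = init_states vO vE T0"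
      "Ud 0 = init_inputs K xb ub vO vE T0"
      "Jd 0 = init_costs (tube_cost l K \<E> T0 xb ub) vO vE T0"
    and episode: "j \<ge> 1"
    and policy: "\<forall>i\<in>{1..j}. \<forall>y. mpc_feasible A B \<X> \<U> \<W> (Xd (i - 1)) y \<longrightarrow>
      mpc_optimal A B \<X> \<U> \<W> l ws p (Xd (i - 1)) (Jd (i - 1)) y (pol i y)"
    and realization: "\<omega> \<in> space \<Omega>" "\<forall>i k. w i k \<omega> \<in> \<W>"
    and trajectory: "\<forall>i\<in>{1..j}. x i 0 = xS \<and>
      (\<forall>k. x i (Suc k) = A *v x i k + B *v pol i (x i k) + w i k \<omega>)"
    and completed: "\<forall>i\<in>{1..<j}. x i (T i) \<in> \<O>"
    and exploration: "\<forall>i\<in>{1..<j}. \<forall>k\<le>T i.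
      explores A B \<X> Hu hu \<W> vW l ws p (Xd (i - 1)) (Jd (i - 1)) (x i k) (pol i (x i k)) (xW i k)"
    and data_update: "\<forall>i\<in>{1..<j}.
      Xd i = Xd (i - 1) @ new_states (length vW) (T i) (x i) (xW i) \<and>
      Ud i = Ud (i - 1) @ map (pol i) (new_states (length vW) (T i) (x i) (xW i)) \<and>
      Jd i = Jd (i - 1) @ map (mpc_value A B \<X> \<U> \<W> l ws p (Xd (i - 1)) (Jd (i - 1)))
        (new_states (length vW) (T i) (x i) (xW i))"
  shows "mpc_feasible A B \<X> \<U> \<W> (Xd (j - 1)) (x j k)"
proof -
  have zero: "0 \<in> \<W>"
    using disturbance_set(4) interior_subset by blast
  have convex: "convex \<X>" "convex \<U>"
    using state_constraints input_constraints(1) by (simp_all add: convex_matrix_le)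
  have KO: "(*v) K ` \<O> \<subseteq> \<U>"
    using cost by (simp add: stage_cost_def)
  let ?feasible = "\<lambda>i. mpc_feasible A B \<X> \<U> \<W> (Xd i)"
  \<comment> \<open>Episode \<open>Suc i\<close> is controlled with the data \<open>Xd i\<close>.
    This fact serves both the induction step and the conclusion.\<close>
  have trajectory_mem: "x (Suc i) k \<in> safe_set (Xd i)"
    if "Suc i \<le> j" "xS \<in> safe_set (Xd i)" "\<And>z. z \<in> safe_set (Xd i) \<Longrightarrow> ?feasible i z" for i k
  proof (rule closed_loop_in_safe_set)
    have i: "Suc i \<in> {1..j}" using that(1) by simp
    show "x (Suc i) 0 \<in> safe_set (Xd i)"
      using trajectory i that(2) by simp
    show "x (Suc i) (Suc k) = A *v x (Suc i) k + B *v pol (Suc i) (x (Suc i) k) + w (Suc i) k \<omega>"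
      for k using trajectory i by blast
    show "mpc_optimal A B \<X> \<U> \<W> l ws p (Xd i) (Jd i) z (pol (Suc i) z)" if "?feasible i z" for z
      using policy[rule_format, OF i, of z] that by simp
    show "w (Suc i) k \<omega> \<in> \<W>" for k
      using realization(2) by blast
  qed (fact that(3))
  \<comment> \<open>The initial state is part of the invariant because every episode restarts at
    \<open>xS\<close>. The bound \<open>i < j\<close> is the range in which the data are
    specified.\<close>
  have invariant: "xS \<in> safe_set (Xd i) \<and> (\<forall>z\<in>safe_set (Xd i). ?feasible i z)" if "i < j" for i
    using that
  proof (induction i)
    case 0
    have "?feasible 0 z" if "z \<in> set (Xd 0)" for z
      using mpc_feasible_init_states[OF tube zero terminal_set(1,2,4,5) KO tube_vertices] that
      by (simp add: initial_data(1))
    moreover have "xS \<in> safe_set (Xd 0)"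
      using initial_state_in_tube_section[OF tube zero terminal_set(6)]
        tube_sections_subset_safe_set[OF tube tube_vertices, of 0] by (auto simp: initial_data(1))
    ultimately show ?case
      using mpc_feasible_safe_set[OF convex] by blast
  next
    case (Suc i)
    then have xS: "xS \<in> safe_set (Xd i)"
      and inv: "\<And>z. z \<in> safe_set (Xd i) \<Longrightarrow> ?feasible i z"
      by auto
    have i: "Suc i \<in> {1..<j}" using Suc.prems by simp
    let ?new = "new_states (length vW) (T (Suc i)) (x (Suc i)) (xW (Suc i))"
    have Xd: "Xd (Suc i) = Xd i @ ?new"
      using data_update i by simp
    \<comment> \<open>New columns are first shown feasible for the old data \<open>Xd i\<close>;
      monotonicity then passes to \<open>Xd (Suc i)\<close>.\<close>
    have "?feasible i z" if "z \<in> set ?new" for z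
    proof -
      from that consider k where "z = x (Suc i) k"
        | k m where "k \<le> T (Suc i)" "m < length vW" "z = xW (Suc i) k m"
        by (fastforce simp: new_states_def less_Suc_eq_le simp del: upt_Suc)
      then show ?thesis
      proof cases
        case 1
        then show ?thesis
          using trajectory_mem Suc.prems xS inv by simp
      next
        case 2
        then show ?thesis
          using mpc_feasible_explores[OF exploration[rule_format, OF i 2(1)] 2(2) disturbance_set(5)]
            inv input_constraints(1) by simp
      qed
    qed
    moreover have "?feasible i z" if "z \<in> set (Xd i)" for z
      using inv that by (simp add: safe_set_def hull_inc)
    ultimately have "?feasible (Suc i) z" if "z \<in> set (Xd (Suc i))" for z
      using that mpc_feasible_mono[of A B \<X> \<U> \<W> "Xd i" z "Xd (Suc i)"] by (auto simp: Xd)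
    moreover have "safe_set (Xd i) \<subseteq> safe_set (Xd (Suc i))"
      by (simp add: safe_set_def Xd hull_mono)
    ultimately show ?case
      using mpc_feasible_safe_set[OF convex] xS by blast
  qed
  \<comment> \<open>Episode \<open>j\<close> uses the data with index \<open>j - 1 = i\<close>, for
    which the invariant is available.\<close>
  obtain i where "j = Suc i"
    using episode by (cases j) auto
  then show ?thesis
    using invariant[of i] trajectory_mem[of i k] by simp
qed

end
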